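(* Let $\mathcal Q$ have objects, hom-sets that are complete lattices, and two compositions such that $(\mathcal Q,\otimes,\top_a)$ and $(\mathcal Q^{co},\oplus,\bot_a)$ are quantaloids (with the same objects and the same underlying hom-sets). Then $\mathsf{Matr}\mathcal Q$, with the two compositions $\otimes,\oplus$ and identities given in the context, is a linear quantaloid if and only if $\mathcal Q$ is a linear quantaloid.
   Context: A quantaloid is a category enriched in complete lattices and sup-preserving maps; composition is written in diagrammatic order. $\mathcal Q^{co}$ denotes $\mathcal Q$ with the order on each hom reversed, so $(\mathcal Q^{co},\oplus,\bot_a)$ being a quantaloid means $\oplus$ is associative with identities $\bot_a$ and preserves arbitrary infima in each variable. A linear quantaloid is such a (locally small) structure satisfying in addition, for all $f\colon a\to b$, $g\colon b\to c$, $h\colon c\to d$: $f\otimes(g\oplus h)\le(f\otimes g)\oplus h$ and $(f\oplus g)\otimes h\le f\oplus(g\otimes h)$. $\mathsf{Matr}\mathcal Q$: objects are pairs $(X,\gamma)$ with $X$ a (small) set and $\gamma\colon X\to\mathrm{ob}\,\mathcal Q$ a function; arrows $r\colon(X,\gamma)\nrightarrow(Y,\phi)$ are families $(r_{x,y}\colon\gamma(x)\to\phi(y))_{(x,y)\in X\times Y}$ of morphisms of $\mathcal Q$, ordered pointwise. For $r\colon(X,\gamma)\nrightarrow(Y,\phi)$ and $s\colon(Y,\phi)\nrightarrow(Z,\chi)$: $(r\otimes s)_{x,z}=\bigvee_{y\in Y}r_{x,y}\otimes s_{y,z}$ and $(r\oplus s)_{x,z}=\bigwedge_{y\in Y}r_{x,y}\oplus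 s_{y,z}$. The $\otimes$-identity on $(X,\gamma)$ has entries $\top_{\gamma(x)}$ for $x=x'$ and the bottom element of $\mathcal Q(\gamma(x),\gamma(x'))$ for $x\ne x'$; the $\oplus$-identity has entries $\bot_{\gamma(x)}$ for $x=x'$ and the top element of $\mathcal Q(\gamma(x),\gamma(x'))$ for $x\neq x'$. *)

theory Defs
  imports "HOL-Algebra.Complete_Lattice" "HOL-Library.FuncSet"
begin

(* Composition is in diagrammatic order: for f in q_hom C a b and g in q_hom C b c, the composite
   is q_comp C a b c f g in q_hom C a c. Order, composition and identities are all indexed by
   objects, so the hom-sets are not required to be disjoint. *)
record ('o, 'm) quantaloid_data =
  q_ob :: "'o set"
  q_hom :: "'o \<Rightarrow> 'o \<Rightarrow> 'm gorder"
  q_comp :: "'o \<Rightarrow> 'o \<Rightarrow> 'o \<Rightarrow> 'm \<Rightarrow> 'm \<Rightarrow> 'm"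
  q_id :: "'o \<Rightarrow> 'm"

locale quantaloid =
  fixes C :: "('o, 'm) quantaloid_data"
  assumes hom_complete_lattice:
      "\<lbrakk>a \<in> q_ob C; b \<in> q_ob C\<rbrakk> \<Longrightarrow> complete_lattice (q_hom C a b)"
    and comp_closed:
      "\<lbrakk>a \<in> q_ob C; b \<in> q_ob C; c \<in> q_ob C;
        f \<in> carrier (q_hom C a b); g \<in> carrier (q_hom C b c)\<rbrakk>
       \<Longrightarrow> q_comp C a b c f g \<in> carrier (q_hom C a c)"
    and id_closed:
      "a \<in> q_ob C \<Longrightarrow> q_id C a \<in> carrier (q_hom C a a)"
    and comp_assoc:
      "\<lbrakk>a \<in> q_ob C; b \<in> q_ob C; c \<in> q_ob C; d \<in> q_ob C;
        f \<in> carrier (q_hom C a b); g \<in> carrier (q_hom C b c); h \<in> carrier (q_hom C c d)\<rbrakk>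
       \<Longrightarrow> q_comp C a c d (q_comp C a b c f g) h = q_comp C a b d f (q_comp C b c d g h)"
    and id_left:
      "\<lbrakk>a \<in> q_ob C; b \<in> q_ob C; f \<in> carrier (q_hom C a b)\<rbrakk>
       \<Longrightarrow> q_comp C a a b (q_id C a) f = f"
    and id_right:
      "\<lbrakk>a \<in> q_ob C; b \<in> q_ob C; f \<in> carrier (q_hom C a b)\<rbrakk>
       \<Longrightarrow> q_comp C a b b f (q_id C b) = f"
    and comp_sup_left:
      "\<lbrakk>a \<in> q_ob C; b \<in> q_ob C; c \<in> q_ob C; g \<in> carrier (q_hom C b c)\<rbrakk>
       \<Longrightarrow> sup_pres (q_hom C a b) (q_hom C a c) (\<lambda>f. q_comp C a b c f g)"
    and comp_sup_right:
      "\<lbrakk>a \<in> q_ob C; b \<in> q_ob C; c \<in> q_ob C; f \<in> carrier (q_hom C a b)\<rbrakk>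
       \<Longrightarrow> sup_pres (q_hom C b c) (q_hom C a c) (\<lambda>g. q_comp C a b c f g)"

record ('o, 'm) two_comp_data =
  ob :: "'o set"
  Hom :: "'o \<Rightarrow> 'o \<Rightarrow> 'm gorder"
  tensor :: "'o \<Rightarrow> 'o \<Rightarrow> 'o \<Rightarrow> 'm \<Rightarrow> 'm \<Rightarrow> 'm"
  tensor_id :: "'o \<Rightarrow> 'm"
  par :: "'o \<Rightarrow> 'o \<Rightarrow> 'o \<Rightarrow> 'm \<Rightarrow> 'm \<Rightarrow> 'm"
  par_id :: "'o \<Rightarrow> 'm"

(* (Q, tensor, tensor_id) *)
definition tensor_part :: "('o, 'm) two_comp_data \<Rightarrow> ('o, 'm) quantaloid_data" where
  "tensor_part Q =
     \<lparr>q_ob = ob Q, q_hom = Hom Q, q_comp = tensor Q, q_id = tensor_id Q\<rparr>"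

(* (Q^co, par, par_id): the hom orders are reversed, so suprema here are infima in Q *)
definition co_par_part :: "('o, 'm) two_comp_data \<Rightarrow> ('o, 'm) quantaloid_data" where
  "co_par_part Q =
     \<lparr>q_ob = ob Q, q_hom = (\<lambda>a b. inv_gorder (Hom Q a b)), q_comp = par Q, q_id = par_id Q\<rparr>"

locale linear_quantaloid =
  fixes Q :: "('o, 'm) two_comp_data"
  assumes tensor_quantaloid: "quantaloid (tensor_part Q)"
    and par_quantaloid: "quantaloid (co_par_part Q)"
    and distrib_left:
      "\<lbrakk>a \<in> ob Q; b \<in> ob Q; c \<in> ob Q; d \<in> ob Q;
        f \<in> carrier (Hom Q a b); g \<in> carrier (Hom Q b c); h \<in> carrier (Hom Q c d)\<rbrakk>
       \<Longrightarrow> tensor Q a b d f (par Q b c d g h)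
             \<sqsubseteq>\<^bsub>Hom Q a d\<^esub> par Q a c d (tensor Q a b c f g) h"
    and distrib_right:
      "\<lbrakk>a \<in> ob Q; b \<in> ob Q; c \<in> ob Q; d \<in> ob Q;
        f \<in> carrier (Hom Q a b); g \<in> carrier (Hom Q b c); h \<in> carrier (Hom Q c d)\<rbrakk>
       \<Longrightarrow> tensor Q a c d (par Q a b c f g) h
             \<sqsubseteq>\<^bsub>Hom Q a d\<^esub> par Q a b d f (tensor Q b c d g h)"

(* The index sets X range over the subsets of an arbitrary type 'x. Typings and matrices are
   extensional functions, so that equality of objects and arrows is the intended one. *)
type_synonym ('x, 'o) mat_ob = "'x set \<times> ('x \<Rightarrow> 'o)"
type_synonym ('x, 'm) mat = "'x \<times> 'x \<Rightarrow> 'm"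

definition mat_obs :: "('o, 'm) two_comp_data \<Rightarrow> ('x, 'o) mat_ob set" where
  "mat_obs Q = {(X, \<gamma>). \<gamma> \<in> X \<rightarrow>\<^sub>E ob Q}"

fun mat_hom ::
  "('o, 'm) two_comp_data \<Rightarrow> ('x, 'o) mat_ob \<Rightarrow> ('x, 'o) mat_ob \<Rightarrow> ('x, 'm) mat gorder" where
  "mat_hom Q (X, \<gamma>) (Y, \<phi>) =
     \<lparr>carrier = (\<Pi>\<^sub>E (x, y) \<in> X \<times> Y. carrier (Hom Q (\<gamma> x) (\<phi> y))),
      eq = (=),
      le = (\<lambda>r s. \<forall>x\<in>X. \<forall>y\<in>Y. r (x, y) \<sqsubseteq>\<^bsub>Hom Q (\<gamma> x) (\<phi> y)\<^esub> s (x, y))\<rparr>"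

fun mat_tensor ::
  "('o, 'm) two_comp_data \<Rightarrow> ('x, 'o) mat_ob \<Rightarrow> ('x, 'o) mat_ob \<Rightarrow> ('x, 'o) mat_ob
    \<Rightarrow> ('x, 'm) mat \<Rightarrow> ('x, 'm) mat \<Rightarrow> ('x, 'm) mat" where
  "mat_tensor Q (X, \<gamma>) (Y, \<phi>) (Z, \<chi>) r s =
     (\<lambda>(x, z) \<in> X \<times> Z. \<Squnion>\<^bsub>Hom Q (\<gamma> x) (\<chi> z)\<^esub>
        ((\<lambda>y. tensor Q (\<gamma> x) (\<phi> y) (\<chi> z) (r (x, y)) (s (y, z))) ` Y))"

fun mat_par ::
  "('o, 'm) two_comp_data \<Rightarrow> ('x, 'o) mat_ob \<Rightarrow> ('x, 'o) mat_ob \<Rightarrow> ('x, 'o) mat_ob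
    \<Rightarrow> ('x, 'm) mat \<Rightarrow> ('x, 'm) mat \<Rightarrow> ('x, 'm) mat" where
  "mat_par Q (X, \<gamma>) (Y, \<phi>) (Z, \<chi>) r s =
     (\<lambda>(x, z) \<in> X \<times> Z. \<Sqinter>\<^bsub>Hom Q (\<gamma> x) (\<chi> z)\<^esub>
        ((\<lambda>y. par Q (\<gamma> x) (\<phi> y) (\<chi> z) (r (x, y)) (s (y, z))) ` Y))"

fun mat_tensor_id :: "('o, 'm) two_comp_data \<Rightarrow> ('x, 'o) mat_ob \<Rightarrow> ('x, 'm) mat" where
  "mat_tensor_id Q (X, \<gamma>) =
     (\<lambda>(x, x') \<in> X \<times> X. if x = x' then tensor_id Q (\<gamma> x) else \<bottom>\<^bsub>Hom Q (\<gamma> x) (\<gamma> x')\<^esub>)"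

fun mat_par_id :: "('o, 'm) two_comp_data \<Rightarrow> ('x, 'o) mat_ob \<Rightarrow> ('x, 'm) mat" where
  "mat_par_id Q (X, \<gamma>) =
     (\<lambda>(x, x') \<in> X \<times> X. if x = x' then par_id Q (\<gamma> x) else \<top>\<^bsub>Hom Q (\<gamma> x) (\<gamma> x')\<^esub>)"

definition Matr ::
  "('o, 'm) two_comp_data \<Rightarrow> (('x, 'o) mat_ob, ('x, 'm) mat) two_comp_data" where
  "Matr Q =
     \<lparr>ob = mat_obs Q, Hom = mat_hom Q,
      tensor = mat_tensor Q, tensor_id = mat_tensor_id Q,
      par = mat_par Q, par_id = mat_par_id Q\<rparr>"

end

theory Submission
  imports Defs
begin

text \<open>
  Only one of the two compositions matters for most of the proof: reversing the hom orders turns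
  the matrix construction for \<open>\<oplus>\<close> into the one for \<open>\<otimes>\<close>, and exchanges the two distributive laws.
  So it suffices that matrices over a single quantaloid form a quantaloid, and that one law passes
  between \<open>Q\<close> and its matrices. Entrywise, the law for matrices is
  \<open>f\<^sub>x\<^sub>y \<otimes> (\<Sqinter>z. g\<^sub>y\<^sub>z \<oplus> h\<^sub>z\<^sub>w) \<le> f\<^sub>x\<^sub>y \<otimes> (g\<^sub>y\<^sub>z \<oplus> h\<^sub>z\<^sub>w) \<le> (f\<^sub>x\<^sub>y \<otimes> g\<^sub>y\<^sub>z) \<oplus> h\<^sub>z\<^sub>w \<le> (\<Squnion>y. f\<^sub>x\<^sub>y \<otimes> g\<^sub>y\<^sub>z) \<oplus> h\<^sub>z\<^sub>w\<close>;
  conversely, the law for \<open>Q\<close> is the law for 1-by-1 matrices.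
\<close>

section \<open>Complete lattices\<close>

context complete_lattice
begin

text \<open>Each \<open>F i j\<close> lies below its column supremum, and so below the supremum of
  all columns. The reverse inequality comes from this one with \<open>I\<close> and \<open>J\<close>
  exchanged.\<close>

lemma sup_image_swap_le:
  assumes "\<And>i j. i \<in> I \<Longrightarrow> j \<in> J \<Longrightarrow> F i j \<in> carrier L"
  shows "\<Squnion>((\<lambda>i. \<Squnion>(F i ` J)) ` I) \<sqsubseteq> \<Squnion>((\<lambda>j. \<Squnion>((\<lambda>i. F i j) ` I)) ` J)"
proof -
  have row: "F i ` J \<subseteq> carrier L" if "i \<in> I" for i using assms that by auto
  have col: "(\<lambda>i. F i j) ` I \<subseteq> carrier L" if "j \<in> J" for j using assms that by auto
  have rhs: "(\<lambda>j. \<Squnion>((\<lambda>i. F i j) ` I)) ` J \<subseteq> carrier L"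
    using col by auto
  have le: "F i j \<sqsubseteq> \<Squnion>((\<lambda>j. \<Squnion>((\<lambda>i. F i j) ` I)) ` J)" if "i \<in> I" "j \<in> J" for i j
  proof (rule le_trans)
    show "F i j \<sqsubseteq> \<Squnion>((\<lambda>i. F i j) ` I)"
      using that by (intro sup_upper col imageI)
    show "\<Squnion>((\<lambda>i. F i j) ` I) \<sqsubseteq> \<Squnion>((\<lambda>j. \<Squnion>((\<lambda>i. F i j) ` I)) ` J)"
      using that by (intro sup_upper rhs imageI)
  qed (use that assms col rhs in auto)
  show ?thesis
    by (rule sup_least) (use row rhs in \<open>auto intro!: sup_least le\<close>)
qed

lemma sup_image_swap:
  assumes "\<And>i j. i \<in> I \<Longrightarrow> j \<in> J \<Longrightarrow> F i j \<in> carrier L"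
  shows "\<Squnion>((\<lambda>i. \<Squnion>(F i ` J)) ` I) = \<Squnion>((\<lambda>j. \<Squnion>((\<lambda>i. F i j) ` I)) ` J)"
proof (rule le_antisym)
  show "\<Squnion>((\<lambda>i. \<Squnion>(F i ` J)) ` I) \<sqsubseteq> \<Squnion>((\<lambda>j. \<Squnion>((\<lambda>i. F i j) ` I)) ` J)"
    using assms by (rule sup_image_swap_le)
  show "\<Squnion>((\<lambda>j. \<Squnion>((\<lambda>i. F i j) ` I)) ` J) \<sqsubseteq> \<Squnion>((\<lambda>i. \<Squnion>(F i ` J)) ` I)"
    using sup_image_swap_le[of J I "\<lambda>j i. F i j"] assms by simp
qed (use assms in \<open>auto intro!: sup_closed\<close>)

text \<open>Serves multiplication by an identity matrix, where every term off the diagonal is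
  bottom.\<close>

lemma sup_image_eq_single:
  assumes "k \<in> I" "F k \<in> carrier L" "\<And>i. i \<in> I \<Longrightarrow> i \<noteq> k \<Longrightarrow> F i = \<bottom>"
  shows "\<Squnion>(F ` I) = F k"
proof (rule le_antisym)
  have F: "F ` I \<subseteq> carrier L" using assms by (metis bottom_closed image_subsetI)
  then show "\<Squnion>(F ` I) \<in> carrier L" by simp
  show "F k \<sqsubseteq> \<Squnion>(F ` I)" using F assms(1) by (auto intro: sup_upper)
  show "\<Squnion>(F ` I) \<sqsubseteq> F k"
    by (rule sup_least) (use F assms in \<open>auto, metis bottom_lower le_refl\<close>)
qed (fact assms(2))

lemma sup_empty: "\<Squnion>{} = \<bottom>"
  using weak_sup_empty by (simp add: eq_is_equal)

text \<open>\<open>\<Squnion>\<close> is a chosen least upper bound; uniqueness lets any explicitly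
  given one compute it.\<close>

lemma sup_eqI:
  assumes "least L s (Upper L A)"
  shows "\<Squnion>A = s"
  using assms by (metis least_unique someI sup_def)

end

text \<open>The order is recovered from joins: if \<open>x\<close> is below \<open>y\<close>, then
  \<open>y\<close> is the supremum of \<open>{x, y}\<close>. The memberships of \<open>f x\<close>
  and \<open>f y\<close> are separate hypotheses because \<open>sup_pres\<close> does not say that
  \<open>f\<close> maps carrier into carrier.\<close>

lemma sup_pres_mono:
  assumes "sup_pres L M f" "x \<in> carrier L" "y \<in> carrier L" "x \<sqsubseteq>\<^bsub>L\<^esub> y"
    and "f x \<in> carrier M" "f y \<in> carrier M"
  shows "f x \<sqsubseteq>\<^bsub>M\<^esub> f y"
proof -
  interpret L: complete_lattice L using assms(1) by (simp add: sup_pres_def)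
  interpret M: complete_lattice M using assms(1) by (simp add: sup_pres_def)
  have "\<Squnion>\<^bsub>L\<^esub>{x, y} = y"
    by (rule L.le_antisym) (use assms in \<open>auto intro: L.sup_least L.sup_upper\<close>)
  then have "f y = \<Squnion>\<^bsub>M\<^esub>{f x, f y}"
    using assms by (auto simp: sup_pres_def dest: spec[of _ "{x, y}"])
  then show ?thesis
    using assms M.sup_upper[of "{f x, f y}" "f x"] by simp
qed

section \<open>Products of complete lattices\<close>

text \<open>Hom-sets of matrices are the case \<open>I = X \<times> Y\<close>. Elements are
  extensional, so pointwise equality on \<open>I\<close> is equality, which gives
  antisymmetry.\<close>

definition prod_order :: "'i set \<Rightarrow> ('i \<Rightarrow> 'm gorder) \<Rightarrow> ('i \<Rightarrow> 'm) gorder" where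
  "prod_order I L =
     \<lparr>carrier = (\<Pi>\<^sub>E i\<in>I. carrier (L i)), eq = (=),
      le = (\<lambda>r s. \<forall>i\<in>I. r i \<sqsubseteq>\<^bsub>L i\<^esub> s i)\<rparr>"

lemma prod_order_sel [simp]:
  "carrier (prod_order I L) = (\<Pi>\<^sub>E i\<in>I. carrier (L i))"
  "eq (prod_order I L) = (=)"
  "le (prod_order I L) r s \<longleftrightarrow> (\<forall>i\<in>I. r i \<sqsubseteq>\<^bsub>L i\<^esub> s i)"
  by (simp_all add: prod_order_def)

lemma inv_prod_order: "inv_gorder (prod_order I L) = prod_order I (\<lambda>i. inv_gorder (L i))"
  by (simp add: prod_order_def)

context
  fixes I :: "'i set" and L :: "'i \<Rightarrow> 'm gorder"
  assumes factor: "\<And>i. i \<in> I \<Longrightarrow> complete_lattice (L i)"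
begin

lemma partial_order_prod_order: "partial_order (prod_order I L)"
proof (unfold_locales)
  fix r s assume rs: "r \<in> carrier (prod_order I L)" "s \<in> carrier (prod_order I L)"
    and le: "r \<sqsubseteq>\<^bsub>prod_order I L\<^esub> s" "s \<sqsubseteq>\<^bsub>prod_order I L\<^esub> r"
  have "r i = s i" if "i \<in> I" for i
  proof -
    interpret complete_lattice "L i" using factor that .
    show ?thesis using rs le that by (auto intro!: le_antisym dest: PiE_mem)
  qed
  then show "r .=\<^bsub>prod_order I L\<^esub> s" using rs by (auto intro: PiE_ext)
next
  fix r assume r: "r \<in> carrier (prod_order I L)"
  have "r i \<sqsubseteq>\<^bsub>L i\<^esub> r i" if "i \<in> I" for i
  proof -
    interpret complete_lattice "L i" using factor that .
    show ?thesis using r that by (auto dest: PiE_mem)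
  qed
  then show "r \<sqsubseteq>\<^bsub>prod_order I L\<^esub> r" by simp
next
  fix r s t
  assume rst: "r \<in> carrier (prod_order I L)" "s \<in> carrier (prod_order I L)"
      "t \<in> carrier (prod_order I L)"
    and le: "r \<sqsubseteq>\<^bsub>prod_order I L\<^esub> s" "s \<sqsubseteq>\<^bsub>prod_order I L\<^esub> t"
  have "r i \<sqsubseteq>\<^bsub>L i\<^esub> t i" if "i \<in> I" for i
  proof -
    interpret complete_lattice "L i" using factor that .
    show ?thesis using rst le that by (auto intro: le_trans[of _ "s i"] dest: PiE_mem)
  qed
  then show "r \<sqsubseteq>\<^bsub>prod_order I L\<^esub> t" by simp
qed simp_all

text \<open>Suprema are formed pointwise. The claim is phrased with \<open>least\<close> because it
  also has to supply the existence of suprema, before the product is known to be a complete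
  lattice.\<close>

lemma prod_order_least:
  assumes "A \<subseteq> carrier (prod_order I L)"
  shows "least (prod_order I L) (\<lambda>i\<in>I. \<Squnion>\<^bsub>L i\<^esub>((\<lambda>r. r i) ` A)) (Upper (prod_order I L) A)"
proof -
  have sub: "(\<lambda>r. r i) ` A \<subseteq> carrier (L i)" if "i \<in> I" for i
    using assms that by auto
  show ?thesis
  proof (rule least_UpperI)
    fix r assume r: "r \<in> A"
    have "r i \<sqsubseteq>\<^bsub>L i\<^esub> \<Squnion>\<^bsub>L i\<^esub>((\<lambda>r. r i) ` A)" if "i \<in> I" for i
    proof -
      interpret complete_lattice "L i" using factor that .
      show ?thesis using r that by (intro sup_upper sub imageI)
    qed
    then show "r \<sqsubseteq>\<^bsub>prod_order I L\<^esub> (\<lambda>i\<in>I. \<Squnion>\<^bsub>L i\<^esub>((\<lambda>r. r i) ` A))" by simp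
  next
    fix s assume s: "s \<in> Upper (prod_order I L) A"
    have "\<Squnion>\<^bsub>L i\<^esub>((\<lambda>r. r i) ` A) \<sqsubseteq>\<^bsub>L i\<^esub> s i" if "i \<in> I" for i
    proof -
      interpret complete_lattice "L i" using factor that .
      show ?thesis
        by (rule sup_least) (use s sub that assms in \<open>auto simp: Upper_def\<close>)
    qed
    then show "(\<lambda>i\<in>I. \<Squnion>\<^bsub>L i\<^esub>((\<lambda>r. r i) ` A)) \<sqsubseteq>\<^bsub>prod_order I L\<^esub> s" by simp
  next
    have "\<Squnion>\<^bsub>L i\<^esub>((\<lambda>r. r i) ` A) \<in> carrier (L i)" if "i \<in> I" for i
    proof -
      interpret complete_lattice "L i" using factor that .
      show ?thesis using sub that by simp
    qed
    then show "(\<lambda>i\<in>I. \<Squnion>\<^bsub>L i\<^esub>((\<lambda>r. r i) ` A)) \<in> carrier (prod_order I L)" by simp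
  qed (use assms in simp)
qed

end

text \<open>The dual is a weak complete lattice; reversal keeps \<open>eq\<close> as plain equality,
  which makes it a complete lattice proper.\<close>

lemma complete_lattice_inv:
  assumes "complete_lattice L"
  shows "complete_lattice (inv_gorder L)"
proof -
  interpret complete_lattice L by (fact assms)
  interpret dual: weak_complete_lattice "inv_gorder L" by (rule dual_weak_complete_lattice)
  show ?thesis
    by unfold_locales (use dual.sup_exists dual.inf_exists in \<open>simp_all only:\<close>,
        simp add: eq_is_equal)
qed

lemma complete_lattice_prod_order:
  assumes "\<And>i. i \<in> I \<Longrightarrow> complete_lattice (L i)"
  shows "complete_lattice (prod_order I L)"
proof -
  interpret P: partial_order "prod_order I L"
    using assms by (rule partial_order_prod_order)
  show ?thesis
  proof
    fix A assume A: "A \<subseteq> carrier (prod_order I L)"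
    show "\<exists>s. least (prod_order I L) s (Upper (prod_order I L) A)"
      using prod_order_least[OF assms A] by blast
    \<comment> \<open>Infima are suprema for the reversed order, and reversing a product reverses
      each factor, so \<open>prod_order_least\<close> applies once more.\<close>
    have "\<exists>s. least (prod_order I (\<lambda>i. inv_gorder (L i))) s
        (Upper (prod_order I (\<lambda>i. inv_gorder (L i))) A)"
      by (rule exI, rule prod_order_least) (use A assms in \<open>auto intro: complete_lattice_inv\<close>)
    then show "\<exists>s. greatest (prod_order I L) s (Lower (prod_order I L) A)"
      by (simp only: inv_prod_order[symmetric] least_dual Upper_dual)
  qed
qed

lemma sup_prod_order:
  assumes "\<And>i. i \<in> I \<Longrightarrow> complete_lattice (L i)" "A \<subseteq> carrier (prod_order I L)"
  shows "\<Squnion>\<^bsub>prod_order I L\<^esub> A = (\<lambda>i\<in>I. \<Squnion>\<^bsub>L i\<^esub>((\<lambda>r. r i) ` A))"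
  by (rule complete_lattice.sup_eqI[OF complete_lattice_prod_order prod_order_least])
    (use assms in auto)

section \<open>Matrices over a quantaloid\<close>

text \<open>Suprema and bottoms are those of the hom order of \<open>C\<close>. For
  \<open>C = co_par_part Q\<close> they are infima and tops of \<open>Q\<close>, so this one
  construction yields both compositions of \<open>Matr Q\<close>.\<close>

definition mat_quantaloid ::
  "('o, 'm) quantaloid_data \<Rightarrow> (('x, 'o) mat_ob, ('x, 'm) mat) quantaloid_data" where
  "mat_quantaloid C =
     \<lparr>q_ob = {(X, \<gamma>). \<gamma> \<in> X \<rightarrow>\<^sub>E q_ob C},
      q_hom = (\<lambda>(X, \<gamma>) (Y, \<phi>). prod_order (X \<times> Y) (\<lambda>(x, y). q_hom C (\<gamma> x) (\<phi> y))),
      q_comp = (\<lambda>(X, \<gamma>) (Y, \<phi>) (Z, \<chi>) r s. \<lambda>(x, z)\<in>X \<times> Z.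
        \<Squnion>\<^bsub>q_hom C (\<gamma> x) (\<chi> z)\<^esub>
          ((\<lambda>y. q_comp C (\<gamma> x) (\<phi> y) (\<chi> z) (r (x, y)) (s (y, z))) ` Y)),
      q_id = (\<lambda>(X, \<gamma>). \<lambda>(x, x')\<in>X \<times> X.
        if x = x' then q_id C (\<gamma> x) else \<bottom>\<^bsub>q_hom C (\<gamma> x) (\<gamma> x')\<^esub>)\<rparr>"

lemma mat_quantaloid_sel [simp]:
  "(X, \<gamma>) \<in> q_ob (mat_quantaloid C) \<longleftrightarrow> \<gamma> \<in> X \<rightarrow>\<^sub>E q_ob C"
  "q_hom (mat_quantaloid C) (X, \<gamma>) (Y, \<phi>) =
     prod_order (X \<times> Y) (\<lambda>(x, y). q_hom C (\<gamma> x) (\<phi> y))"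
  "q_comp (mat_quantaloid C) (X, \<gamma>) (Y, \<phi>) (Z, \<chi>) r s = (\<lambda>(x, z)\<in>X \<times> Z.
     \<Squnion>\<^bsub>q_hom C (\<gamma> x) (\<chi> z)\<^esub>
       ((\<lambda>y. q_comp C (\<gamma> x) (\<phi> y) (\<chi> z) (r (x, y)) (s (y, z))) ` Y))"
  "q_id (mat_quantaloid C) (X, \<gamma>) = (\<lambda>(x, x')\<in>X \<times> X.
     if x = x' then q_id C (\<gamma> x) else \<bottom>\<^bsub>q_hom C (\<gamma> x) (\<gamma> x')\<^esub>)"
  by (simp_all add: mat_quantaloid_def)

lemma mat_ob_cases:
  fixes a :: "('x, 'o) mat_ob"
  assumes "a \<in> q_ob (mat_quantaloid C)"
  obtains X \<gamma> where "a = (X, \<gamma>)" "\<gamma> \<in> X \<rightarrow>\<^sub>E q_ob C"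
  using assms by (cases a) auto

text \<open>With \<open>h = carrier\<close> this reconciles \<open>prod_order\<close>, which takes
  the carrier of a family over pairs, with \<open>mat_hom\<close>, which matches on the pair
  first.\<close>

lemma case_prod_of_case_prod: "h (case p of (x, y) \<Rightarrow> F x y) = (case p of (x, y) \<Rightarrow> h (F x y))"
  by (simp split: prod.split)

lemma tensor_part_Matr: "tensor_part (Matr Q) = mat_quantaloid (tensor_part Q)"
  by (auto simp: tensor_part_def Matr_def mat_quantaloid_def mat_obs_def prod_order_def fun_eq_iff
      case_prod_of_case_prod[where h = carrier])

text \<open>Reversing an order exchanges \<open>\<Squnion>\<close> with \<open>\<Sqinter>\<close>
  and \<open>\<bottom>\<close> with \<open>\<top>\<close> by the very definitions, so the equality
  holds for arbitrary data.\<close>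

lemma co_par_part_Matr: "co_par_part (Matr Q) = mat_quantaloid (co_par_part Q)"
  by (auto simp: co_par_part_def Matr_def mat_quantaloid_def mat_obs_def prod_order_def fun_eq_iff
      case_prod_of_case_prod[where h = carrier])

context quantaloid
begin

lemma comp_image_closed:
  assumes "a \<in> q_ob C" "c \<in> q_ob C"
    and "\<And>y. y \<in> Y \<Longrightarrow> b y \<in> q_ob C"
    and "\<And>y. y \<in> Y \<Longrightarrow> f y \<in> carrier (q_hom C a (b y))"
    and "\<And>y. y \<in> Y \<Longrightarrow> g y \<in> carrier (q_hom C (b y) c)"
  shows "\<Squnion>\<^bsub>q_hom C a c\<^esub>((\<lambda>y. q_comp C a (b y) c (f y) (g y)) ` Y) \<in> carrier (q_hom C a c)"
proof -
  interpret complete_lattice "q_hom C a c" using assms by (intro hom_complete_lattice)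
  show ?thesis using assms by (intro sup_closed) (auto intro!: comp_closed)
qed

section \<open>Composition in one quantaloid: indexed suprema, bottom, monotonicity\<close>

lemma comp_sup_left_image:
  assumes "a \<in> q_ob C" "b \<in> q_ob C" "c \<in> q_ob C" "g \<in> carrier (q_hom C b c)"
    and "\<And>i. i \<in> I \<Longrightarrow> f i \<in> carrier (q_hom C a b)"
  shows "q_comp C a b c (\<Squnion>\<^bsub>q_hom C a b\<^esub>(f ` I)) g = \<Squnion>\<^bsub>q_hom C a c\<^esub>((\<lambda>i. q_comp C a b c (f i) g) ` I)"
  using comp_sup_left[OF assms(1-4)] assms(5)
  by (auto simp: sup_pres_def image_image dest!: spec[of _ "f ` I"])

lemma comp_sup_right_image:
  assumes "a \<in> q_ob C" "b \<in> q_ob C" "c \<in> q_ob C" "f \<in> carrier (q_hom C a b)"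
    and "\<And>i. i \<in> I \<Longrightarrow> g i \<in> carrier (q_hom C b c)"
  shows "q_comp C a b c f (\<Squnion>\<^bsub>q_hom C b c\<^esub>(g ` I)) = \<Squnion>\<^bsub>q_hom C a c\<^esub>((\<lambda>i. q_comp C a b c f (g i)) ` I)"
  using comp_sup_right[OF assms(1-4)] assms(5)
  by (auto simp: sup_pres_def image_image dest!: spec[of _ "g ` I"])

text \<open>Bottom is the empty supremum, so this is preservation of suprema for the empty
  family.\<close>

lemma comp_bottom_left:
  assumes "a \<in> q_ob C" "b \<in> q_ob C" "c \<in> q_ob C" "g \<in> carrier (q_hom C b c)"
  shows "q_comp C a b c \<bottom>\<^bsub>q_hom C a b\<^esub> g = \<bottom>\<^bsub>q_hom C a c\<^esub>"
  using comp_sup_left_image[OF assms, of "{}" undefined] assms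
  by (simp add: complete_lattice.sup_empty hom_complete_lattice)

lemma comp_bottom_right:
  assumes "a \<in> q_ob C" "b \<in> q_ob C" "c \<in> q_ob C" "f \<in> carrier (q_hom C a b)"
  shows "q_comp C a b c f \<bottom>\<^bsub>q_hom C b c\<^esub> = \<bottom>\<^bsub>q_hom C a c\<^esub>"
  using comp_sup_right_image[OF assms, of "{}" undefined] assms
  by (simp add: complete_lattice.sup_empty hom_complete_lattice)

lemma comp_mono_left:
  assumes "a \<in> q_ob C" "b \<in> q_ob C" "c \<in> q_ob C" "g \<in> carrier (q_hom C b c)"
    and "f \<in> carrier (q_hom C a b)" "f' \<in> carrier (q_hom C a b)" "f \<sqsubseteq>\<^bsub>q_hom C a b\<^esub> f'"
  shows "q_comp C a b c f g \<sqsubseteq>\<^bsub>q_hom C a c\<^esub> q_comp C a b c f' g"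
  by (rule sup_pres_mono[OF comp_sup_left[OF assms(1-4)]]) (use assms in \<open>auto intro: comp_closed\<close>)

lemma comp_mono_right:
  assumes "a \<in> q_ob C" "b \<in> q_ob C" "c \<in> q_ob C" "f \<in> carrier (q_hom C a b)"
    and "g \<in> carrier (q_hom C b c)" "g' \<in> carrier (q_hom C b c)" "g \<sqsubseteq>\<^bsub>q_hom C b c\<^esub> g'"
  shows "q_comp C a b c f g \<sqsubseteq>\<^bsub>q_hom C a c\<^esub> q_comp C a b c f g'"
  by (rule sup_pres_mono[OF comp_sup_right[OF assms(1-4)]]) (use assms in \<open>auto intro: comp_closed\<close>)

section \<open>Hom-lattices and composition of matrices\<close>

abbreviation mat ::
  "('x, 'o) mat_ob \<Rightarrow> ('x, 'o) mat_ob \<Rightarrow> ('x, 'm) mat gorder" where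
  "mat \<equiv> q_hom (mat_quantaloid C)"

lemma mat_hom_complete_lattice:
  assumes "\<gamma> \<in> X \<rightarrow>\<^sub>E q_ob C" "\<phi> \<in> Y \<rightarrow>\<^sub>E q_ob C"
  shows "complete_lattice (mat (X, \<gamma>) (Y, \<phi>))"
  using assms by (simp, intro complete_lattice_prod_order) (auto intro!: hom_complete_lattice)

lemma mat_hom_sup:
  assumes "\<gamma> \<in> X \<rightarrow>\<^sub>E q_ob C" "\<phi> \<in> Y \<rightarrow>\<^sub>E q_ob C" "A \<subseteq> carrier (mat (X, \<gamma>) (Y, \<phi>))"
  shows "\<Squnion>\<^bsub>mat (X, \<gamma>) (Y, \<phi>)\<^esub> A =
    (\<lambda>(x, y)\<in>X \<times> Y. \<Squnion>\<^bsub>q_hom C (\<gamma> x) (\<phi> y)\<^esub>((\<lambda>r. r (x, y)) ` A))"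
  unfolding mat_quantaloid_sel(2)
  by (subst sup_prod_order)
    (use assms in \<open>auto intro!: hom_complete_lattice simp: fun_eq_iff restrict_def\<close>)

lemma mat_entry:
  assumes "r \<in> carrier (mat (X, \<gamma>) (Y, \<phi>))" "x \<in> X" "y \<in> Y"
  shows "r (x, y) \<in> carrier (q_hom C (\<gamma> x) (\<phi> y))"
  using assms by (auto dest: PiE_mem)

lemma mat_comp_closed:
  assumes ob: "\<gamma> \<in> X \<rightarrow>\<^sub>E q_ob C" "\<phi> \<in> Y \<rightarrow>\<^sub>E q_ob C" "\<chi> \<in> Z \<rightarrow>\<^sub>E q_ob C"
    and r: "r \<in> carrier (mat (X, \<gamma>) (Y, \<phi>))" and s: "s \<in> carrier (mat (Y, \<phi>) (Z, \<chi>))"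
  shows "q_comp (mat_quantaloid C) (X, \<gamma>) (Y, \<phi>) (Z, \<chi>) r s \<in> carrier (mat (X, \<gamma>) (Z, \<chi>))"
proof -
  have obX: "\<gamma> x \<in> q_ob C" if "x \<in> X" for x using ob that by auto
  have obY: "\<phi> y \<in> q_ob C" if "y \<in> Y" for y using ob that by auto
  have obZ: "\<chi> z \<in> q_ob C" if "z \<in> Z" for z using ob that by auto
  have "\<Squnion>\<^bsub>q_hom C (\<gamma> x) (\<chi> z)\<^esub>
      ((\<lambda>y. q_comp C (\<gamma> x) (\<phi> y) (\<chi> z) (r (x, y)) (s (y, z))) ` Y) \<in> carrier (q_hom C (\<gamma> x) (\<chi> z))"
    if xz: "x \<in> X" "z \<in> Z" for x z
    by (rule comp_image_closed) (simp_all only: obX obY obZ mat_entry[OF r] mat_entry[OF s] xz)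
  then show ?thesis by auto
qed

text \<open>Suprema of matrices are entrywise, so in each summand over \<open>y\<close> the supremum
  over \<open>A\<close> comes out by the corresponding property of \<open>C\<close>. Interchanging
  the suprema over \<open>y\<close> and over \<open>A\<close> then gives the claim.\<close>

lemma mat_comp_sup_left:
  assumes ob: "\<gamma> \<in> X \<rightarrow>\<^sub>E q_ob C" "\<phi> \<in> Y \<rightarrow>\<^sub>E q_ob C" "\<chi> \<in> Z \<rightarrow>\<^sub>E q_ob C"
    and s: "s \<in> carrier (mat (Y, \<phi>) (Z, \<chi>))"
  shows "sup_pres (mat (X, \<gamma>) (Y, \<phi>)) (mat (X, \<gamma>) (Z, \<chi>))
    (\<lambda>r. q_comp (mat_quantaloid C) (X, \<gamma>) (Y, \<phi>) (Z, \<chi>) r s)"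
  unfolding sup_pres_def
proof (intro conjI mat_hom_complete_lattice ob allI impI)
  fix A assume A: "A \<subseteq> carrier (mat (X, \<gamma>) (Y, \<phi>))"
  let ?c = "\<lambda>r. q_comp (mat_quantaloid C) (X, \<gamma>) (Y, \<phi>) (Z, \<chi>) r s"
  let ?S = "\<Squnion>\<^bsub>mat (X, \<gamma>) (Y, \<phi>)\<^esub> A"
  have cA: "?c ` A \<subseteq> carrier (mat (X, \<gamma>) (Z, \<chi>))"
    using mat_comp_closed[OF ob _ s] A by blast
  have obX: "\<gamma> x \<in> q_ob C" if "x \<in> X" for x using ob that by auto
  have obY: "\<phi> y \<in> q_ob C" if "y \<in> Y" for y using ob that by auto
  have obZ: "\<chi> z \<in> q_ob C" if "z \<in> Z" for z using ob that by auto
  have s': "s (y, z) \<in> carrier (q_hom C (\<phi> y) (\<chi> z))"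
    if "y \<in> Y" "z \<in> Z" for y z
    using s that by (rule mat_entry)
  have A': "r (x, y) \<in> carrier (q_hom C (\<gamma> x) (\<phi> y))"
    if "r \<in> A" "x \<in> X" "y \<in> Y" for r x y
    using subsetD[OF A that(1)] that(2,3) by (rule mat_entry)
  have eq: "\<Squnion>\<^bsub>q_hom C (\<gamma> x) (\<chi> z)\<^esub>
        ((\<lambda>y. q_comp C (\<gamma> x) (\<phi> y) (\<chi> z) (?S (x, y)) (s (y, z))) ` Y) =
      \<Squnion>\<^bsub>q_hom C (\<gamma> x) (\<chi> z)\<^esub> ((\<lambda>r. r (x, z)) ` ?c ` A)" if xz: "x \<in> X" "z \<in> Z" for x z
  proof -
    interpret complete_lattice "q_hom C (\<gamma> x) (\<chi> z)"
      using obX obZ xz by (intro hom_complete_lattice)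
    let ?F = "\<lambda>r y. q_comp C (\<gamma> x) (\<phi> y) (\<chi> z) (r (x, y)) (s (y, z))"
    have "?F ?S y = \<Squnion>\<^bsub>q_hom C (\<gamma> x) (\<chi> z)\<^esub> ((\<lambda>r. ?F r y) ` A)" if "y \<in> Y" for y
    proof -
      have S: "?S (x, y) = \<Squnion>\<^bsub>q_hom C (\<gamma> x) (\<phi> y)\<^esub> ((\<lambda>r. r (x, y)) ` A)"
        unfolding mat_hom_sup[OF ob(1,2) A] using xz that by simp
      show ?thesis
        unfolding S
        by (rule comp_sup_left_image) (simp_all add: obX obY obZ s' A' xz that)
    qed
    then have "\<Squnion>\<^bsub>q_hom C (\<gamma> x) (\<chi> z)\<^esub> (?F ?S ` Y) =
        \<Squnion>\<^bsub>q_hom C (\<gamma> x) (\<chi> z)\<^esub> ((\<lambda>y. \<Squnion>\<^bsub>q_hom C (\<gamma> x) (\<chi> z)\<^esub> ((\<lambda>r. ?F r y) ` A)) ` Y)"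
      by (simp cong: image_cong_simp)
    also have "\<dots> = \<Squnion>\<^bsub>q_hom C (\<gamma> x) (\<chi> z)\<^esub> ((\<lambda>r. \<Squnion>\<^bsub>q_hom C (\<gamma> x) (\<chi> z)\<^esub> (?F r ` Y)) ` A)"
      by (rule sup_image_swap, rule comp_closed) (simp_all add: obX obY obZ s' A' xz)
    finally show ?thesis using xz by (simp add: image_image)
  qed
  show "?c ?S = \<Squnion>\<^bsub>mat (X, \<gamma>) (Z, \<chi>)\<^esub> (?c ` A)"
    unfolding mat_hom_sup[OF ob(1,3) cA] using eq by (simp add: fun_eq_iff restrict_def)
qed

lemma mat_comp_sup_right:
  assumes ob: "\<gamma> \<in> X \<rightarrow>\<^sub>E q_ob C" "\<phi> \<in> Y \<rightarrow>\<^sub>E q_ob C" "\<chi> \<in> Z \<rightarrow>\<^sub>E q_ob C"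
    and r: "r \<in> carrier (mat (X, \<gamma>) (Y, \<phi>))"
  shows "sup_pres (mat (Y, \<phi>) (Z, \<chi>)) (mat (X, \<gamma>) (Z, \<chi>))
    (\<lambda>s. q_comp (mat_quantaloid C) (X, \<gamma>) (Y, \<phi>) (Z, \<chi>) r s)"
  unfolding sup_pres_def
proof (intro conjI mat_hom_complete_lattice ob allI impI)
  fix A assume A: "A \<subseteq> carrier (mat (Y, \<phi>) (Z, \<chi>))"
  let ?c = "\<lambda>s. q_comp (mat_quantaloid C) (X, \<gamma>) (Y, \<phi>) (Z, \<chi>) r s"
  let ?S = "\<Squnion>\<^bsub>mat (Y, \<phi>) (Z, \<chi>)\<^esub> A"
  have cA: "?c ` A \<subseteq> carrier (mat (X, \<gamma>) (Z, \<chi>))"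
    using mat_comp_closed[OF ob r] A by blast
  have obX: "\<gamma> x \<in> q_ob C" if "x \<in> X" for x using ob that by auto
  have obY: "\<phi> y \<in> q_ob C" if "y \<in> Y" for y using ob that by auto
  have obZ: "\<chi> z \<in> q_ob C" if "z \<in> Z" for z using ob that by auto
  have r': "r (x, y) \<in> carrier (q_hom C (\<gamma> x) (\<phi> y))"
    if "x \<in> X" "y \<in> Y" for x y
    using r that by (rule mat_entry)
  have A': "s (y, z) \<in> carrier (q_hom C (\<phi> y) (\<chi> z))"
    if "s \<in> A" "y \<in> Y" "z \<in> Z" for s y z
    using subsetD[OF A that(1)] that(2,3) by (rule mat_entry)
  have eq: "\<Squnion>\<^bsub>q_hom C (\<gamma> x) (\<chi> z)\<^esub>
        ((\<lambda>y. q_comp C (\<gamma> x) (\<phi> y) (\<chi> z) (r (x, y)) (?S (y, z))) ` Y) =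
      \<Squnion>\<^bsub>q_hom C (\<gamma> x) (\<chi> z)\<^esub> ((\<lambda>s. s (x, z)) ` ?c ` A)" if xz: "x \<in> X" "z \<in> Z" for x z
  proof -
    interpret complete_lattice "q_hom C (\<gamma> x) (\<chi> z)"
      using obX obZ xz by (intro hom_complete_lattice)
    let ?F = "\<lambda>s y. q_comp C (\<gamma> x) (\<phi> y) (\<chi> z) (r (x, y)) (s (y, z))"
    have "?F ?S y = \<Squnion>\<^bsub>q_hom C (\<gamma> x) (\<chi> z)\<^esub> ((\<lambda>s. ?F s y) ` A)" if "y \<in> Y" for y
    proof -
      have S: "?S (y, z) = \<Squnion>\<^bsub>q_hom C (\<phi> y) (\<chi> z)\<^esub> ((\<lambda>s. s (y, z)) ` A)"
        unfolding mat_hom_sup[OF ob(2,3) A] using xz that by simp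
      show ?thesis
        unfolding S
        by (rule comp_sup_right_image) (simp_all add: obX obY obZ r' A' xz that)
    qed
    then have "\<Squnion>\<^bsub>q_hom C (\<gamma> x) (\<chi> z)\<^esub> (?F ?S ` Y) =
        \<Squnion>\<^bsub>q_hom C (\<gamma> x) (\<chi> z)\<^esub> ((\<lambda>y. \<Squnion>\<^bsub>q_hom C (\<gamma> x) (\<chi> z)\<^esub> ((\<lambda>s. ?F s y) ` A)) ` Y)"
      by (simp cong: image_cong_simp)
    also have "\<dots> = \<Squnion>\<^bsub>q_hom C (\<gamma> x) (\<chi> z)\<^esub> ((\<lambda>s. \<Squnion>\<^bsub>q_hom C (\<gamma> x) (\<chi> z)\<^esub> (?F s ` Y)) ` A)"
      by (rule sup_image_swap, rule comp_closed) (simp_all add: obX obY obZ r' A' xz)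
    finally show ?thesis using xz by (simp add: image_image)
  qed
  show "?c ?S = \<Squnion>\<^bsub>mat (X, \<gamma>) (Z, \<chi>)\<^esub> (?c ` A)"
    unfolding mat_hom_sup[OF ob(1,3) cA] using eq by (simp add: fun_eq_iff restrict_def)
qed

text \<open>At an entry \<open>(x, w)\<close> both sides reduce to the double supremum of the triple
  composites \<open>?F y z\<close>: on the left by distributing over the inner supremum, on the
  right by distributing and then using associativity in \<open>C\<close>. The two orders of
  summation agree by \<open>sup_image_swap\<close>.\<close>

lemma mat_comp_assoc:
  assumes ob: "\<gamma> \<in> X \<rightarrow>\<^sub>E q_ob C" "\<phi> \<in> Y \<rightarrow>\<^sub>E q_ob C" "\<chi> \<in> Z \<rightarrow>\<^sub>E q_ob C" "\<psi> \<in> W \<rightarrow>\<^sub>E q_ob C"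
    and r: "r \<in> carrier (mat (X, \<gamma>) (Y, \<phi>))" and s: "s \<in> carrier (mat (Y, \<phi>) (Z, \<chi>))"
    and t: "t \<in> carrier (mat (Z, \<chi>) (W, \<psi>))"
  shows "q_comp (mat_quantaloid C) (X, \<gamma>) (Z, \<chi>) (W, \<psi>)
      (q_comp (mat_quantaloid C) (X, \<gamma>) (Y, \<phi>) (Z, \<chi>) r s) t =
    q_comp (mat_quantaloid C) (X, \<gamma>) (Y, \<phi>) (W, \<psi>) r
      (q_comp (mat_quantaloid C) (Y, \<phi>) (Z, \<chi>) (W, \<psi>) s t)"
proof -
  have obX: "\<gamma> x \<in> q_ob C" if "x \<in> X" for x using ob that by auto
  have obY: "\<phi> y \<in> q_ob C" if "y \<in> Y" for y using ob that by auto
  have obZ: "\<chi> z \<in> q_ob C" if "z \<in> Z" for z using ob that by auto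
  have obW: "\<psi> w \<in> q_ob C" if "w \<in> W" for w using ob that by auto
  have r': "r (x, y) \<in> carrier (q_hom C (\<gamma> x) (\<phi> y))"
    if "x \<in> X" "y \<in> Y" for x y
    using r that by (rule mat_entry)
  have s': "s (y, z) \<in> carrier (q_hom C (\<phi> y) (\<chi> z))"
    if "y \<in> Y" "z \<in> Z" for y z
    using s that by (rule mat_entry)
  have t': "t (z, w) \<in> carrier (q_hom C (\<chi> z) (\<psi> w))"
    if "z \<in> Z" "w \<in> W" for z w
    using t that by (rule mat_entry)
  have "\<Squnion>\<^bsub>q_hom C (\<gamma> x) (\<psi> w)\<^esub> ((\<lambda>z. q_comp C (\<gamma> x) (\<chi> z) (\<psi> w)
        (\<Squnion>\<^bsub>q_hom C (\<gamma> x) (\<chi> z)\<^esub>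
          ((\<lambda>y. q_comp C (\<gamma> x) (\<phi> y) (\<chi> z) (r (x, y)) (s (y, z))) ` Y)) (t (z, w))) ` Z) =
      \<Squnion>\<^bsub>q_hom C (\<gamma> x) (\<psi> w)\<^esub> ((\<lambda>y. q_comp C (\<gamma> x) (\<phi> y) (\<psi> w) (r (x, y))
        (\<Squnion>\<^bsub>q_hom C (\<phi> y) (\<psi> w)\<^esub>
          ((\<lambda>z. q_comp C (\<phi> y) (\<chi> z) (\<psi> w) (s (y, z)) (t (z, w))) ` Z))) ` Y)"
    (is "?l = ?r") if xw: "x \<in> X" "w \<in> W" for x w
  proof -
    interpret complete_lattice "q_hom C (\<gamma> x) (\<psi> w)"
      using obX obW xw by (intro hom_complete_lattice)
    let ?F = "\<lambda>y z. q_comp C (\<gamma> x) (\<chi> z) (\<psi> w)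
      (q_comp C (\<gamma> x) (\<phi> y) (\<chi> z) (r (x, y)) (s (y, z))) (t (z, w))"
    have left: "q_comp C (\<gamma> x) (\<chi> z) (\<psi> w)
        (\<Squnion>\<^bsub>q_hom C (\<gamma> x) (\<chi> z)\<^esub>
          ((\<lambda>y. q_comp C (\<gamma> x) (\<phi> y) (\<chi> z) (r (x, y)) (s (y, z))) ` Y)) (t (z, w)) =
        \<Squnion>\<^bsub>q_hom C (\<gamma> x) (\<psi> w)\<^esub> ((\<lambda>y. ?F y z) ` Y)" if "z \<in> Z" for z
      by (rule comp_sup_left_image) (simp_all add: obX obY obZ obW r' s' t' xw that comp_closed)
    have right: "q_comp C (\<gamma> x) (\<phi> y) (\<psi> w) (r (x, y))
        (\<Squnion>\<^bsub>q_hom C (\<phi> y) (\<psi> w)\<^esub>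
          ((\<lambda>z. q_comp C (\<phi> y) (\<chi> z) (\<psi> w) (s (y, z)) (t (z, w))) ` Z)) =
        \<Squnion>\<^bsub>q_hom C (\<gamma> x) (\<psi> w)\<^esub> (?F y ` Z)" if y: "y \<in> Y" for y
    proof -
      have "q_comp C (\<gamma> x) (\<phi> y) (\<psi> w) (r (x, y))
          (q_comp C (\<phi> y) (\<chi> z) (\<psi> w) (s (y, z)) (t (z, w))) = ?F y z" if "z \<in> Z" for z
        by (rule comp_assoc[symmetric]) (simp_all add: obX obY obZ obW r' s' t' xw y that)
      then show ?thesis
        by (subst comp_sup_right_image)
          (simp_all add: obX obY obZ obW r' s' t' xw y comp_closed cong: image_cong_simp)
    qed
    have "?l = \<Squnion>\<^bsub>q_hom C (\<gamma> x) (\<psi> w)\<^esub> ((\<lambda>z. \<Squnion>\<^bsub>q_hom C (\<gamma> x) (\<psi> w)\<^esub> ((\<lambda>y. ?F y z) ` Y)) ` Z)"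
      using left by (simp cong: image_cong_simp)
    also have "\<dots> = \<Squnion>\<^bsub>q_hom C (\<gamma> x) (\<psi> w)\<^esub> ((\<lambda>y. \<Squnion>\<^bsub>q_hom C (\<gamma> x) (\<psi> w)\<^esub> (?F y ` Z)) ` Y)"
      by (rule sup_image_swap, rule comp_closed) (simp_all add: obX obY obZ obW r' s' t' xw comp_closed)
    also have "\<dots> = ?r"
      using right by (simp cong: image_cong_simp)
    finally show ?thesis .
  qed
  then show ?thesis by (auto simp: fun_eq_iff restrict_def cong: image_cong_simp)
qed

section \<open>Identity matrices and the quantaloid axioms\<close>

lemma mat_id_closed:
  assumes "\<gamma> \<in> X \<rightarrow>\<^sub>E q_ob C"
  shows "q_id (mat_quantaloid C) (X, \<gamma>) \<in> carrier (mat (X, \<gamma>) (X, \<gamma>))"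
proof -
  have "\<bottom>\<^bsub>q_hom C a b\<^esub> \<in> carrier (q_hom C a b)" if ab: "a \<in> q_ob C" "b \<in> q_ob C" for a b
  proof -
    interpret complete_lattice "q_hom C a b" using ab by (rule hom_complete_lattice)
    show ?thesis by simp
  qed
  moreover have "\<gamma> x \<in> q_ob C" if "x \<in> X" for x using assms that by auto
  ultimately show ?thesis by (auto simp: id_closed)
qed

text \<open>Composition with bottom gives bottom, so only the summand at \<open>x' = x\<close>
  survives, and there the unit law of \<open>C\<close> applies.\<close>

lemma mat_id_left:
  assumes ob: "\<gamma> \<in> X \<rightarrow>\<^sub>E q_ob C" "\<phi> \<in> Y \<rightarrow>\<^sub>E q_ob C" and r: "r \<in> carrier (mat (X, \<gamma>) (Y, \<phi>))"
  shows "q_comp (mat_quantaloid C) (X, \<gamma>) (X, \<gamma>) (Y, \<phi>) (q_id (mat_quantaloid C) (X, \<gamma>)) r = r"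
proof -
  have obX: "\<gamma> x \<in> q_ob C" if "x \<in> X" for x using ob that by auto
  have obY: "\<phi> y \<in> q_ob C" if "y \<in> Y" for y using ob that by auto
  have r': "r (x, y) \<in> carrier (q_hom C (\<gamma> x) (\<phi> y))"
    if "x \<in> X" "y \<in> Y" for x y
    using r that by (rule mat_entry)
  have "\<Squnion>\<^bsub>q_hom C (\<gamma> x) (\<phi> y)\<^esub> ((\<lambda>x'. q_comp C (\<gamma> x) (\<gamma> x') (\<phi> y)
      (if x = x' then q_id C (\<gamma> x) else \<bottom>\<^bsub>q_hom C (\<gamma> x) (\<gamma> x')\<^esub>) (r (x', y))) ` X) = r (x, y)"
    if xy: "x \<in> X" "y \<in> Y" for x y
  proof -
    interpret complete_lattice "q_hom C (\<gamma> x) (\<phi> y)"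
      using obX obY xy by (intro hom_complete_lattice)
    have *: "q_comp C (\<gamma> x) (\<gamma> x) (\<phi> y) (q_id C (\<gamma> x)) (r (x, y)) = r (x, y)"
      by (rule id_left) (simp_all add: obX obY r' xy)
    show ?thesis
      by (subst sup_image_eq_single[of x]) (simp_all add: * obX obY r' xy comp_bottom_left)
  qed
  \<comment> \<open>Outside \<open>X \<times> Y\<close> both sides are \<open>undefined\<close>: the
    composite by restriction, \<open>r\<close> by extensionality.\<close>
  then show ?thesis
    using r by (auto simp: fun_eq_iff restrict_def PiE_iff extensional_def)
qed

lemma mat_id_right:
  assumes ob: "\<gamma> \<in> X \<rightarrow>\<^sub>E q_ob C" "\<phi> \<in> Y \<rightarrow>\<^sub>E q_ob C" and r: "r \<in> carrier (mat (X, \<gamma>) (Y, \<phi>))"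
  shows "q_comp (mat_quantaloid C) (X, \<gamma>) (Y, \<phi>) (Y, \<phi>) r (q_id (mat_quantaloid C) (Y, \<phi>)) = r"
proof -
  have obX: "\<gamma> x \<in> q_ob C" if "x \<in> X" for x using ob that by auto
  have obY: "\<phi> y \<in> q_ob C" if "y \<in> Y" for y using ob that by auto
  have r': "r (x, y) \<in> carrier (q_hom C (\<gamma> x) (\<phi> y))"
    if "x \<in> X" "y \<in> Y" for x y
    using r that by (rule mat_entry)
  have "\<Squnion>\<^bsub>q_hom C (\<gamma> x) (\<phi> y)\<^esub> ((\<lambda>y'. q_comp C (\<gamma> x) (\<phi> y') (\<phi> y) (r (x, y'))
      (if y' = y then q_id C (\<phi> y') else \<bottom>\<^bsub>q_hom C (\<phi> y') (\<phi> y)\<^esub>)) ` Y) = r (x, y)"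
    if xy: "x \<in> X" "y \<in> Y" for x y
  proof -
    interpret complete_lattice "q_hom C (\<gamma> x) (\<phi> y)"
      using obX obY xy by (intro hom_complete_lattice)
    have *: "q_comp C (\<gamma> x) (\<phi> y) (\<phi> y) (r (x, y)) (q_id C (\<phi> y)) = r (x, y)"
      by (rule id_right) (simp_all add: obX obY r' xy)
    show ?thesis
      by (subst sup_image_eq_single[of y]) (simp_all add: * obX obY r' xy comp_bottom_right)
  qed
  then show ?thesis
    using r by (auto simp: fun_eq_iff restrict_def PiE_iff extensional_def)
qed

lemma quantaloid_mat:
  "quantaloid (mat_quantaloid C :: (('x, 'o) mat_ob, ('x, 'm) mat) quantaloid_data)"
proof (rule quantaloid.intro, goal_cases)
  case (1 a b)
  then show ?case by (elim mat_ob_cases) (hypsubst, rule mat_hom_complete_lattice)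
next
  case (2 a b c f g)
  then show ?case by (elim mat_ob_cases) (hypsubst, rule mat_comp_closed)
next
  case (3 a)
  then show ?case by (elim mat_ob_cases) (hypsubst, rule mat_id_closed)
next
  case (4 a b c d f g h)
  then show ?case by (elim mat_ob_cases) (hypsubst, rule mat_comp_assoc)
next
  case (5 a b f)
  then show ?case by (elim mat_ob_cases) (hypsubst, rule mat_id_left)
next
  case (6 a b f)
  then show ?case by (elim mat_ob_cases) (hypsubst, rule mat_id_right)
next
  case (7 a b c g)
  then show ?case by (elim mat_ob_cases) (hypsubst, rule mat_comp_sup_left)
next
  case (8 a b c f)
  then show ?case by (elim mat_ob_cases) (hypsubst, rule mat_comp_sup_right)
qed

end

section \<open>Distributivity\<close>

text \<open>
  With \<open>C\<close> and \<open>D\<close> the two parts of \<open>Q\<close> this is the left distributive law; exchanging them reverses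
  the hom orders and gives the right distributive law.
\<close>

definition lax_distrib :: "('o, 'm) quantaloid_data \<Rightarrow> ('o, 'm) quantaloid_data \<Rightarrow> bool" where
  "lax_distrib C D \<longleftrightarrow>
     (\<forall>a\<in>q_ob C. \<forall>b\<in>q_ob C. \<forall>c\<in>q_ob C. \<forall>d\<in>q_ob C.
      \<forall>f\<in>carrier (q_hom C a b). \<forall>g\<in>carrier (q_hom C b c). \<forall>h\<in>carrier (q_hom C c d).
        q_comp C a b d f (q_comp D b c d g h)
          \<sqsubseteq>\<^bsub>q_hom C a d\<^esub> q_comp D a c d (q_comp C a b c f g) h)"

text \<open>For the exchanged pair, \<open>f \<oplus> (g \<otimes> h)\<close> below
  \<open>(f \<oplus> g) \<otimes> h\<close> in the reversed order is
  \<open>distrib_right\<close>.\<close>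

lemma linear_quantaloid_iff_lax_distrib:
  "linear_quantaloid Q \<longleftrightarrow>
     quantaloid (tensor_part Q) \<and> quantaloid (co_par_part Q) \<and>
     lax_distrib (tensor_part Q) (co_par_part Q) \<and> lax_distrib (co_par_part Q) (tensor_part Q)"
proof
  assume "linear_quantaloid Q"
  then interpret linear_quantaloid Q .
  show "quantaloid (tensor_part Q) \<and> quantaloid (co_par_part Q) \<and>
     lax_distrib (tensor_part Q) (co_par_part Q) \<and> lax_distrib (co_par_part Q) (tensor_part Q)"
    using tensor_quantaloid par_quantaloid
    by (simp add: lax_distrib_def tensor_part_def co_par_part_def distrib_left distrib_right)
next
  assume "quantaloid (tensor_part Q) \<and> quantaloid (co_par_part Q) \<and>
     lax_distrib (tensor_part Q) (co_par_part Q) \<and> lax_distrib (co_par_part Q) (tensor_part Q)"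
  then show "linear_quantaloid Q"
    by (intro linear_quantaloid.intro) (simp_all add: lax_distrib_def tensor_part_def co_par_part_def)
qed

text \<open>Abstracts from which composition is the tensor. The two parts of \<open>Q\<close> fit in
  either order, so one proof about \<open>lax_distrib\<close> covers both distributive laws.\<close>

locale dual_quantaloids = C: quantaloid C + D: quantaloid D for C D :: "('o, 'm) quantaloid_data" +
  assumes ob_eq: "q_ob D = q_ob C"
    and hom_eq: "q_hom D a b = inv_gorder (q_hom C a b)"
begin

lemma hom_carrier: "carrier (q_hom D a b) = carrier (q_hom C a b)"
  by (simp add: hom_eq)

lemma hom_le: "f \<sqsubseteq>\<^bsub>q_hom D a b\<^esub> g \<longleftrightarrow> g \<sqsubseteq>\<^bsub>q_hom C a b\<^esub> f"
  by (simp add: hom_eq)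

lemma lax_distrib_mat:
  assumes CD: "lax_distrib C D"
  shows "lax_distrib (mat_quantaloid C :: (('x, 'o) mat_ob, ('x, 'm) mat) quantaloid_data)
    (mat_quantaloid D)"
  unfolding lax_distrib_def
proof (intro ballI, goal_cases)
  case (1 a b c d f g h)
  obtain X \<gamma> where a: "a = (X, \<gamma>)" "\<gamma> \<in> X \<rightarrow>\<^sub>E q_ob C" using 1(1) by (rule mat_ob_cases)
  obtain Y \<phi> where b: "b = (Y, \<phi>)" "\<phi> \<in> Y \<rightarrow>\<^sub>E q_ob C" using 1(2) by (rule mat_ob_cases)
  obtain Z \<chi> where c: "c = (Z, \<chi>)" "\<chi> \<in> Z \<rightarrow>\<^sub>E q_ob C" using 1(3) by (rule mat_ob_cases)
  obtain W \<psi> where d: "d = (W, \<psi>)" "\<psi> \<in> W \<rightarrow>\<^sub>E q_ob C" using 1(4) by (rule mat_ob_cases)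
  have f: "f (x, y) \<in> carrier (q_hom C (\<gamma> x) (\<phi> y))" if "x \<in> X" "y \<in> Y" for x y
    using 1(5) that unfolding a(1) b(1) by (rule C.mat_entry)
  have g: "g (y, z) \<in> carrier (q_hom C (\<phi> y) (\<chi> z))" if "y \<in> Y" "z \<in> Z" for y z
    using 1(6) that unfolding b(1) c(1) by (rule C.mat_entry)
  have h: "h (z, w) \<in> carrier (q_hom C (\<chi> z) (\<psi> w))" if "z \<in> Z" "w \<in> W" for z w
    using 1(7) that unfolding c(1) d(1) by (rule C.mat_entry)
  have obX: "\<gamma> x \<in> q_ob C" if "x \<in> X" for x using a(2) that by auto
  have obY: "\<phi> y \<in> q_ob C" if "y \<in> Y" for y using b(2) that by auto
  have obZ: "\<chi> z \<in> q_ob C" if "z \<in> Z" for z using c(2) that by auto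
  have obW: "\<psi> w \<in> q_ob C" if "w \<in> W" for w using d(2) that by auto
  \<comment> \<open>The matrix law at the entry \<open>(x, w)\<close>. Every
    \<open>\<Squnion>\<close> taken in a hom of \<open>D\<close> is an infimum for the order of
    \<open>C\<close>.\<close>
  have key: "\<Squnion>\<^bsub>q_hom C (\<gamma> x) (\<psi> w)\<^esub> ((\<lambda>y. q_comp C (\<gamma> x) (\<phi> y) (\<psi> w) (f (x, y))
        (\<Squnion>\<^bsub>q_hom D (\<phi> y) (\<psi> w)\<^esub>
          ((\<lambda>z. q_comp D (\<phi> y) (\<chi> z) (\<psi> w) (g (y, z)) (h (z, w))) ` Z))) ` Y)
      \<sqsubseteq>\<^bsub>q_hom C (\<gamma> x) (\<psi> w)\<^esub>
      \<Squnion>\<^bsub>q_hom D (\<gamma> x) (\<psi> w)\<^esub> ((\<lambda>z. q_comp D (\<gamma> x) (\<chi> z) (\<psi> w)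
        (\<Squnion>\<^bsub>q_hom C (\<gamma> x) (\<chi> z)\<^esub>
          ((\<lambda>y. q_comp C (\<gamma> x) (\<phi> y) (\<chi> z) (f (x, y)) (g (y, z))) ` Y)) (h (z, w))) ` Z)"
    if xw: "x \<in> X" "w \<in> W" for x w
  proof -
    let ?fG = "\<lambda>y k. q_comp C (\<gamma> x) (\<phi> y) (\<psi> w) (f (x, y)) k"
    let ?Fh = "\<lambda>z k. q_comp D (\<gamma> x) (\<chi> z) (\<psi> w) k (h (z, w))"
    let ?G = "\<lambda>y. \<Squnion>\<^bsub>q_hom D (\<phi> y) (\<psi> w)\<^esub>
      ((\<lambda>z. q_comp D (\<phi> y) (\<chi> z) (\<psi> w) (g (y, z)) (h (z, w))) ` Z)"
    let ?F = "\<lambda>z. \<Squnion>\<^bsub>q_hom C (\<gamma> x) (\<chi> z)\<^esub>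
      ((\<lambda>y. q_comp C (\<gamma> x) (\<phi> y) (\<chi> z) (f (x, y)) (g (y, z))) ` Y)"
    interpret xw: complete_lattice "q_hom C (\<gamma> x) (\<psi> w)"
      using obX obW xw by (intro C.hom_complete_lattice)
    interpret xw': complete_lattice "q_hom D (\<gamma> x) (\<psi> w)"
      using obX obW xw by (intro D.hom_complete_lattice) (simp_all add: ob_eq)
    have G: "?G y \<in> carrier (q_hom C (\<phi> y) (\<psi> w))" if "y \<in> Y" for y
      unfolding hom_carrier[symmetric]
      by (rule D.comp_image_closed) (use that xw obY obZ obW g h in \<open>simp_all add: ob_eq hom_carrier\<close>)
    have F: "?F z \<in> carrier (q_hom C (\<gamma> x) (\<chi> z))" if "z \<in> Z" for z
      by (rule C.comp_image_closed) (use that xw obX obY obZ f g in simp_all)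
    have fG: "?fG y (?G y) \<in> carrier (q_hom C (\<gamma> x) (\<psi> w))" if "y \<in> Y" for y
      by (rule C.comp_closed) (use that xw obX obY obW f G in simp_all)
    have Fh: "?Fh z (?F z) \<in> carrier (q_hom D (\<gamma> x) (\<psi> w))" if "z \<in> Z" for z
      by (rule D.comp_closed) (use that xw obX obZ obW h F in \<open>simp_all add: ob_eq hom_carrier\<close>)
    \<comment> \<open>For fixed \<open>y\<close> and \<open>z\<close>: shrink to the infimum
      \<open>?G y\<close>, apply the law of \<open>Q\<close>'s parts to single arrows, then enlarge
      to the supremum \<open>?F z\<close>. The outer two steps are monotonicity in \<open>C\<close>
      and in \<open>D\<close>, whose orders are opposite.\<close>
    have le: "?fG y (?G y) \<sqsubseteq>\<^bsub>q_hom C (\<gamma> x) (\<psi> w)\<^esub> ?Fh z (?F z)" if yz: "y \<in> Y" "z \<in> Z" for y z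
    proof -
      let ?gh = "q_comp D (\<phi> y) (\<chi> z) (\<psi> w) (g (y, z)) (h (z, w))"
      let ?fg = "q_comp C (\<gamma> x) (\<phi> y) (\<chi> z) (f (x, y)) (g (y, z))"
      interpret yw: complete_lattice "q_hom D (\<phi> y) (\<psi> w)"
        using obY obW xw yz by (intro D.hom_complete_lattice) (simp_all add: ob_eq)
      interpret xz: complete_lattice "q_hom C (\<gamma> x) (\<chi> z)"
        using obX obZ xw yz by (intro C.hom_complete_lattice)
      have gh: "q_comp D (\<phi> y) (\<chi> z') (\<psi> w) (g (y, z')) (h (z', w)) \<in> carrier (q_hom D (\<phi> y) (\<psi> w))"
        if "z' \<in> Z" for z'
        by (rule D.comp_closed) (use that yz xw obY obZ obW g h in \<open>simp_all add: ob_eq hom_carrier\<close>)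
      have fg: "q_comp C (\<gamma> x) (\<phi> y') (\<chi> z) (f (x, y')) (g (y', z)) \<in> carrier (q_hom C (\<gamma> x) (\<chi> z))"
        if "y' \<in> Y" for y'
        by (rule C.comp_closed) (use that yz xw obX obY obZ f g in simp_all)
      have "?gh \<sqsubseteq>\<^bsub>q_hom D (\<phi> y) (\<psi> w)\<^esub> ?G y"
        using yz gh by (intro yw.sup_upper) auto
      then have 1: "?fG y (?G y) \<sqsubseteq>\<^bsub>q_hom C (\<gamma> x) (\<psi> w)\<^esub> ?fG y ?gh"
        using xw yz obX obY obW f G gh by (intro C.comp_mono_right) (simp_all add: hom_carrier hom_le)
      have 2: "?fG y ?gh \<sqsubseteq>\<^bsub>q_hom C (\<gamma> x) (\<psi> w)\<^esub> ?Fh z ?fg"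
        using CD xw yz obX obY obZ obW f g h by (auto simp: lax_distrib_def)
      have "?fg \<sqsubseteq>\<^bsub>q_hom C (\<gamma> x) (\<chi> z)\<^esub> ?F z"
        using yz fg by (intro xz.sup_upper) auto
      then have "?Fh z (?F z) \<sqsubseteq>\<^bsub>q_hom D (\<gamma> x) (\<psi> w)\<^esub> ?Fh z ?fg"
        using xw yz obX obZ obW h F fg
        by (intro D.comp_mono_left) (simp_all add: ob_eq hom_carrier hom_le)
      then have 3: "?Fh z ?fg \<sqsubseteq>\<^bsub>q_hom C (\<gamma> x) (\<psi> w)\<^esub> ?Fh z (?F z)"
        by (simp only: hom_le)
      have 4: "?fG y ?gh \<in> carrier (q_hom C (\<gamma> x) (\<psi> w))"
        by (rule C.comp_closed) (use yz xw obX obY obW f gh in \<open>simp_all add: hom_carrier\<close>)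
      have 5: "?Fh z ?fg \<in> carrier (q_hom C (\<gamma> x) (\<psi> w))"
        unfolding hom_carrier[symmetric]
        by (rule D.comp_closed) (use yz xw obX obZ obW h fg in \<open>simp_all add: ob_eq hom_carrier\<close>)
      show ?thesis
        by (rule xw.le_trans[OF 1 xw.le_trans[OF 2 3]])
          (simp_all only: 4 5 fG Fh[unfolded hom_carrier] yz)
    qed
    show ?thesis
    \<comment> \<open>A supremum over \<open>y\<close> lies below an infimum over \<open>z\<close>
      as soon as each pair of terms is comparable by \<open>le\<close>. Empty \<open>Y\<close> or
      \<open>Z\<close> needs no separate case.\<close>
    proof (rule xw.sup_least)
      show "(\<lambda>y. ?fG y (?G y)) ` Y \<subseteq> carrier (q_hom C (\<gamma> x) (\<psi> w))"
        using fG by auto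
      show "\<Squnion>\<^bsub>q_hom D (\<gamma> x) (\<psi> w)\<^esub> ((\<lambda>z. ?Fh z (?F z)) ` Z) \<in> carrier (q_hom C (\<gamma> x) (\<psi> w))"
        unfolding hom_carrier[symmetric] using Fh by (intro xw'.sup_closed) auto
      fix k assume "k \<in> (\<lambda>y. ?fG y (?G y)) ` Y"
      then obtain y where y: "y \<in> Y" and k: "k = ?fG y (?G y)" by blast
      have "\<Squnion>\<^bsub>q_hom D (\<gamma> x) (\<psi> w)\<^esub> ((\<lambda>z. ?Fh z (?F z)) ` Z) \<sqsubseteq>\<^bsub>q_hom D (\<gamma> x) (\<psi> w)\<^esub> k"
      proof (rule xw'.sup_least)
        show "(\<lambda>z. ?Fh z (?F z)) ` Z \<subseteq> carrier (q_hom D (\<gamma> x) (\<psi> w))"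
          using Fh by auto
        show "k \<in> carrier (q_hom D (\<gamma> x) (\<psi> w))"
          unfolding hom_carrier k using fG y .
        fix l assume "l \<in> (\<lambda>z. ?Fh z (?F z)) ` Z"
        then obtain z where z: "z \<in> Z" and l: "l = ?Fh z (?F z)" by blast
        show "l \<sqsubseteq>\<^bsub>q_hom D (\<gamma> x) (\<psi> w)\<^esub> k"
          unfolding hom_le k l using le y z .
      qed
      then show "k \<sqsubseteq>\<^bsub>q_hom C (\<gamma> x) (\<psi> w)\<^esub>
          \<Squnion>\<^bsub>q_hom D (\<gamma> x) (\<psi> w)\<^esub> ((\<lambda>z. ?Fh z (?F z)) ` Z)"
        by (simp only: hom_le)
    qed
  qed
  \<comment> \<open>The congruence rule supplies membership of the bound index in \<open>Y\<close>
    or \<open>Z\<close>, which is needed to evaluate the restricted inner composites.\<close>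
  show ?case
    unfolding a(1) b(1) c(1) d(1) by (simp cong: image_cong_simp) (intro ballI key)
qed

lemma lax_distrib_of_mat:
  assumes "lax_distrib (mat_quantaloid C :: (('x, 'o) mat_ob, ('x, 'm) mat) quantaloid_data)
    (mat_quantaloid D)"
  shows "lax_distrib C D"
  unfolding lax_distrib_def
proof (intro ballI)
  fix a b c d f g h
  assume ob: "a \<in> q_ob C" "b \<in> q_ob C" "c \<in> q_ob C" "d \<in> q_ob C"
    and f: "f \<in> carrier (q_hom C a b)" and g: "g \<in> carrier (q_hom C b c)"
    and h: "h \<in> carrier (q_hom C c d)"
  \<comment> \<open>Types are inhabited, so the index type has some \<open>u\<close>; the conclusion
    does not depend on it.\<close>
  fix u :: 'x
  \<comment> \<open>Objects and arrows of \<open>Q\<close> as typings of \<open>{u}\<close> and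
    1-by-1 matrices, restricted to make them extensional.\<close>
  let ?X = "\<lambda>a. ({u}, \<lambda>x\<in>{u}. a)" and ?m = "\<lambda>f. \<lambda>p\<in>{u} \<times> {u}. f"
  \<comment> \<open>These are the four homs in which the composites of 1-by-1 matrices take their
    suprema. Each is the supremum of a singleton and equals its element, given the carrier
    memberships declared as simplification rules below.\<close>
  interpret ad: complete_lattice "q_hom C a d" using ob by (intro C.hom_complete_lattice)
  interpret ac: complete_lattice "q_hom C a c" using ob by (intro C.hom_complete_lattice)
  interpret bd: complete_lattice "q_hom D b d" using ob by (intro D.hom_complete_lattice) (simp_all add: ob_eq)
  interpret ad': complete_lattice "q_hom D a d" using ob by (intro D.hom_complete_lattice) (simp_all add: ob_eq)
  have [simp]: "q_comp C a b c f g \<in> carrier (q_hom C a c)"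
    using ob f g by (intro C.comp_closed)
  have [simp]: "q_comp D b c d g h \<in> carrier (q_hom D b d)"
    using ob g h by (intro D.comp_closed) (simp_all add: ob_eq hom_carrier)
  have [simp]: "q_comp D a c d (q_comp C a b c f g) h \<in> carrier (q_hom D a d)"
    using ob g h by (intro D.comp_closed) (simp_all add: ob_eq hom_carrier)
  have [simp]: "q_comp C a b d f (q_comp D b c d g h) \<in> carrier (q_hom C a d)"
    using ob f by (intro C.comp_closed) (use \<open>q_comp D b c d g h \<in> _\<close> in \<open>simp_all add: ob_eq hom_carrier\<close>)
  have X: "?X a \<in> q_ob (mat_quantaloid C)" if "a \<in> q_ob C" for a
    using that by simp
  have m: "?m f \<in> carrier (C.mat (?X a) (?X b))" if "f \<in> carrier (q_hom C a b)" for a b f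
    using that by simp
  have "q_comp (mat_quantaloid C) (?X a) (?X b) (?X d) (?m f)
        (q_comp (mat_quantaloid D) (?X b) (?X c) (?X d) (?m g) (?m h))
      \<sqsubseteq>\<^bsub>q_hom (mat_quantaloid C) (?X a) (?X d)\<^esub>
      q_comp (mat_quantaloid D) (?X a) (?X c) (?X d)
        (q_comp (mat_quantaloid C) (?X a) (?X b) (?X c) (?m f) (?m g)) (?m h)"
    by (rule assms[unfolded lax_distrib_def, rule_format]) (simp_all only: X m ob f g h)
  then show "q_comp C a b d f (q_comp D b c d g h)
      \<sqsubseteq>\<^bsub>q_hom C a d\<^esub> q_comp D a c d (q_comp C a b c f g) h"
    by simp
qed

end

text \<open>Reversing an order twice restores it.\<close>

lemma dual_quantaloids_sym: "dual_quantaloids C D \<Longrightarrow> dual_quantaloids D C"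
  by (simp add: dual_quantaloids_def dual_quantaloids_axioms_def)

theorem theorem6p10:
  fixes Q :: "('o, 'm) two_comp_data"
  assumes "quantaloid (tensor_part Q)"
    and "quantaloid (co_par_part Q)"
  shows "linear_quantaloid (Matr Q :: (('x, 'o) mat_ob, ('x, 'm) mat) two_comp_data)
           \<longleftrightarrow> linear_quantaloid Q"
proof -
  interpret tp: dual_quantaloids "tensor_part Q" "co_par_part Q"
    using assms by (intro dual_quantaloids.intro dual_quantaloids_axioms.intro)
      (simp_all add: tensor_part_def co_par_part_def)
  interpret pt: dual_quantaloids "co_par_part Q" "tensor_part Q"
    by (rule dual_quantaloids_sym) unfold_locales
  \<comment> \<open>The quantaloid conditions hold on both sides, by \<open>quantaloid_mat\<close>
    for matrices. What remains is the equivalence of each law with its matrix version: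
    \<open>tp\<close> gives the left law and \<open>pt\<close> the right one.\<close>
  show ?thesis
    unfolding linear_quantaloid_iff_lax_distrib tensor_part_Matr co_par_part_Matr
    using assms tp.C.quantaloid_mat tp.D.quantaloid_mat tp.lax_distrib_mat pt.lax_distrib_mat
      tp.lax_distrib_of_mat pt.lax_distrib_of_mat
    by blast
qed

end
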